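(* Let $m\le n$ be positive integers, and let $L_f$ and $L_A$ be positive numbers. For any positive integer $t<\frac m2$, there exists an instance of the affinely constrained problem $\min_{x\in X}\{f(x):\ Ax=b\}$ (with $A\in\mathbb R^{m\times n}$) such that $\nabla f$ is $L_f$-Lipschitz continuous, $\|A\|=L_A$, and it has a primal-dual solution $(x^*,y^* )$. In addition, for any algorithm for solving the affinely constrained problem, if its iterates on this instance satisfy the linear span assumption (see context), then $$|f(x^{(t)})-f(x^* )|\ \ge\ \frac{3L_f\|x^*\|^2}{32(t+1)}+\frac{\sqrt6}{32(t+1)}L_A\|x^*\|\cdot\|y^*\|,$$ $$\|Ax^{(t)}-b\|\ \ge\ \frac{\sqrt3\,L_A\|x^*\|}{4\sqrt2\,(t+1)}.$$
   Context: $\|\cdot\|$ is the Euclidean norm of vectors and the spectral norm of matrices. Affinely constrained problem: $f^*:=\min_{x\in X}\{f(x):\ Ax=b\}$, where $X\subseteq\mathbb R^n$ is closed and convex, $f:\mathbb R^n\to\mathbb R$ is convex and differentiable with Lipschitz continuous gradient, $A\in\mathbb R^{m\times n}$, $b\in\mathbb R^m$. A primal-dual solution is a pair $(x^*,y^* )$ of an optimal solution and an associated Lagrange multiplier (KKT pair; for $X=\mathbb R^n$: $Ax^*=b$ and $\nabla f(x^* )=A^\top y^*$, up to the sign convention for $y^*$, which is immaterial here). Linear span assumption: the iterate sequence $\{x^{(t)}\}_{t\ge0}$ satisfies $x^{(0)}=0$ and, for all $t\ge1$, $$x^{(t)}\in\operatorname{span}\{\nabla f(x^{(0)}),A^\top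 r^{(0)},\nabla f(x^{(1)}),A^\top r^{(1)},\dots,\nabla f(x^{(t-1)}),A^\top r^{(t-1)}\},$$ where $r^{(j)}=Ax^{(j)}-b$. *)

theory Defs
  imports "HOL-Analysis.Analysis"
begin

definition gradient :: "('a::euclidean_space \<Rightarrow> real) \<Rightarrow> 'a \<Rightarrow> 'a" where
  "gradient f x = (THE g. GDERIV f x :> g)"

text \<open>The Euclidean operator norm, i.e. the spectral norm of a matrix.\<close>

definition spectral_norm :: "real ^ 'n ^ 'm \<Rightarrow> real" where
  "spectral_norm A = onorm ((*v) A)"

text \<open>
  The data of a problem of minimizing \<open>f x\<close> over \<open>x \<in> X\<close> subject to \<open>A x = b\<close>.
  There is no condition on \<open>A\<close> and \<open>b\<close>, so they are not parameters here.
\<close>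

definition admissible_data :: "(real ^ 'n) set \<Rightarrow> (real ^ 'n \<Rightarrow> real) \<Rightarrow> bool" where
  "admissible_data X f \<longleftrightarrow>
     closed X \<and> convex X \<and>
     convex_on UNIV f \<and> (\<forall>x. f differentiable at x) \<and>
     (\<exists>L. L-lipschitz_on UNIV (gradient f))"

definition feasible_set :: "(real ^ 'n) set \<Rightarrow> real ^ 'n ^ 'm \<Rightarrow> real ^ 'm \<Rightarrow> (real ^ 'n) set" where
  "feasible_set X A b = {x \<in> X. A *v x = b}"

definition optimal_solution ::
  "(real ^ 'n) set \<Rightarrow> (real ^ 'n \<Rightarrow> real) \<Rightarrow> real ^ 'n ^ 'm \<Rightarrow> real ^ 'm \<Rightarrow> real ^ 'n \<Rightarrow> bool" where
  "optimal_solution X f A b x \<longleftrightarrow>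
     x \<in> feasible_set X A b \<and> (\<forall>z \<in> feasible_set X A b. f x \<le> f z)"

text \<open>
  The inequality says that \<open>A\<^sup>T y - \<nabla>f x\<close> lies in the normal cone of \<open>X\<close> at \<open>x\<close>.
  For \<open>X = UNIV\<close> it is the equation \<open>\<nabla>f x = A\<^sup>T y\<close>, which fixes the sign of \<open>y\<close>.
\<close>

definition primal_dual_solution ::
  "(real ^ 'n) set \<Rightarrow> (real ^ 'n \<Rightarrow> real) \<Rightarrow> real ^ 'n ^ 'm \<Rightarrow> real ^ 'm \<Rightarrow>
   real ^ 'n \<Rightarrow> real ^ 'm \<Rightarrow> bool" where
  "primal_dual_solution X f A b x y \<longleftrightarrow>
     optimal_solution X f A b x \<and>
     (\<forall>z\<in>X. (gradient f x - transpose A *v y) \<bullet> (z - x) \<ge> 0)"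

definition linear_span_assumption ::
  "(real ^ 'n \<Rightarrow> real) \<Rightarrow> real ^ 'n ^ 'm \<Rightarrow> real ^ 'm \<Rightarrow> (nat \<Rightarrow> real ^ 'n) \<Rightarrow> bool" where
  "linear_span_assumption f A b x \<longleftrightarrow>
     x 0 = 0 \<and>
     (\<forall>t\<ge>1. x t \<in> span (\<Union>j<t. {gradient f (x j), transpose A *v (A *v x j - b)}))"

end

theory Submission
  imports Defs
begin

text \<open>
  The instance has \<open>X = UNIV\<close> and lives on a chain of \<open>t + 1\<close> coordinates. The matrix is a
  multiple \<open>s B\<close> of the difference operator \<open>(B x)\<^sub>i = x\<^sub>i - x\<^sub>i\<^sub>-\<^sub>1\<close> (with \<open>x\<^sub>-\<^sub>1 = 0\<close>), the right-hand
  side \<open>b = s e\<^sub>0\<close> forces \<open>x\<^sup>* = (1, \<dots>, 1)\<close>, and the objective \<open>L\<^sub>f / 2 * x\<^sub>t\<^sup>2\<close> only sees the last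
  coordinate. Since \<open>B\<^sup>T B\<close> is tridiagonal, information travels one coordinate per step, so the
  iterate \<open>x\<^sup>(\<^sup>t\<^sup>)\<close> still vanishes at coordinate \<open>t\<close>: its objective value is \<open>0\<close>, against \<open>L\<^sub>f / 2\<close> at
  \<open>x\<^sup>*\<close>. The vector \<open>u = (1, \<dots>, 1)\<close> satisfies \<open>B\<^sup>T u = e\<^sub>t\<close>. Hence \<open>(L\<^sub>f / s) u\<close> is a multiplier, and
  \<open>u \<bullet> (A x - b) = s (x\<^sub>t - 1)\<close> bounds the residual by Cauchy--Schwarz. The constants come from
  \<open>\<parallel>B\<parallel> \<le> 2\<close>, that is \<open>s \<ge> L\<^sub>A / 2\<close>.
\<close>

section \<open>The quadratic objective: gradient and convexity\<close>

lemma gradient_eqI: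
  assumes "GDERIV f x :> g"
  shows "gradient f x = g"
proof -
  have "h = g" if "GDERIV f x :> h" for h
  proof -
    have "(\<lambda>v. v \<bullet> h) = (\<lambda>v. v \<bullet> g)"
      using has_derivative_unique that assms unfolding gderiv_def by blast
    then show ?thesis
      by (metis inner_commute vector_eq_ldot)
  qed
  then show ?thesis
    unfolding gradient_def using assms by blast
qed

lemma GDERIV_square_component:
  fixes c :: real and k :: "'n::finite"
  shows "GDERIV (\<lambda>x. c / 2 * (x $ k)\<^sup>2) x :> (c * x $ k) *\<^sub>R axis k 1"
  unfolding gderiv_def
  by (auto intro!: derivative_eq_intros bounded_linear_imp_has_derivative bounded_linear_vec_nth
      simp: inner_axis fun_eq_iff)

lemma convex_on_square_component:
  fixes c :: real and k :: "'n::finite"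
  assumes "c \<ge> 0"
  shows "convex_on UNIV (\<lambda>x :: real ^ 'n. c * (x $ k)\<^sup>2)"
proof -
  have "convex_on UNIV (\<lambda>x :: real ^ 'n. (x $ k)\<^sup>2)"
  proof (rule convex_onI)
    fix u :: real and x y :: "real ^ 'n"
    assume "0 < u" "u < 1"
    then show "(((1 - u) *\<^sub>R x + u *\<^sub>R y) $ k)\<^sup>2 \<le> (1 - u) * (x $ k)\<^sup>2 + u * (y $ k)\<^sup>2"
      using convex_onD[OF convex_power2, of u "x $ k" "y $ k"] by simp
  qed simp
  then show ?thesis
    using assms by (rule convex_on_cmul[rotated])
qed

section \<open>The difference operator on a chain of coordinates\<close>

definition relabel :: "(nat \<Rightarrow> 'n) \<Rightarrow> (nat \<Rightarrow> 'm) \<Rightarrow> nat set \<Rightarrow> real ^ 'n::finite \<Rightarrow> real ^ 'm::finite"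
  where "relabel p q I x = (\<Sum>i\<in>I. x $ p i *\<^sub>R axis (q i) 1)"

lemma linear_relabel: "linear (relabel p q I)"
  unfolding relabel_def
  by (intro linearI) (simp_all add: scaleR_add_left sum.distrib scaleR_sum_right)

lemma norm_sum_axis:
  fixes q :: "nat \<Rightarrow> 'm::finite"
  assumes "finite I" "inj_on q I"
  shows "(norm (\<Sum>i\<in>I. c i *\<^sub>R axis (q i) (1 :: real)))\<^sup>2 = (\<Sum>i\<in>I. (c i)\<^sup>2)"
proof -
  have "(norm (\<Sum>i\<in>I. c i *\<^sub>R axis (q i) (1 :: real)))\<^sup>2
      = (\<Sum>i\<in>I. (norm (c i *\<^sub>R axis (q i) (1 :: real)))\<^sup>2)"
    using assms
    by (intro norm_sum_Pythagorean) (auto simp: pairwise_def orthogonal_def inner_axis_axis inj_on_def)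
  then show ?thesis
    by (simp add: power_mult_distrib)
qed

lemma norm_relabel_le:
  assumes "finite I" "inj_on p I" "inj_on q I"
  shows "norm (relabel p q I x) \<le> norm x"
proof (rule power2_le_imp_le)
  have "(norm (relabel p q I x))\<^sup>2 = (\<Sum>k\<in>p ` I. (x $ k)\<^sup>2)"
    using assms by (simp add: relabel_def norm_sum_axis sum.reindex)
  also have "\<dots> \<le> (\<Sum>k\<in>UNIV. (x $ k)\<^sup>2)"
    by (intro sum_mono2) auto
  also have "\<dots> = (norm x)\<^sup>2"
    by (simp add: power2_norm_eq_inner inner_vec_def power2_eq_square[of "x $ _"])
  finally show "(norm (relabel p q I x))\<^sup>2 \<le> (norm x)\<^sup>2" .
qed simp

text \<open>Identity part minus shift part of \<open>B\<close>. Finite index types carry no order,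
  so \<open>p\<close> and \<open>q\<close> select the chain among columns and rows.\<close>

definition chain_diff :: "(nat \<Rightarrow> 'n) \<Rightarrow> (nat \<Rightarrow> 'm) \<Rightarrow> nat \<Rightarrow> real ^ 'n::finite \<Rightarrow> real ^ 'm::finite"
  where "chain_diff p q t x = relabel p q {..t} x - relabel p (q \<circ> Suc) {..<t} x"

definition chain_sum :: "(nat \<Rightarrow> 'n) \<Rightarrow> nat \<Rightarrow> real ^ 'n::finite"
  where "chain_sum p t = (\<Sum>i\<le>t. axis (p i) 1)"

lemma linear_chain_diff: "linear (chain_diff p q t)"
  unfolding chain_diff_def by (intro linear_compose_sub linear_relabel)

lemma inner_chain_diff:
  "v \<bullet> chain_diff p q t x = (\<Sum>i\<le>t. x $ p i * v $ q i) - (\<Sum>i<t. x $ p i * v $ q (Suc i))"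
  by (simp add: chain_diff_def relabel_def inner_diff_right inner_sum_right inner_axis)

lemma norm_chain_sum:
  assumes "inj_on p {..t}"
  shows "norm (chain_sum p t) = sqrt (real t + 1)"
proof -
  have "(norm (chain_sum p t))\<^sup>2 = real t + 1"
    using norm_sum_axis[of "{..t}" p "\<lambda>_. 1"] assms by (simp add: chain_sum_def)
  then show ?thesis
    by (metis norm_ge_zero real_sqrt_unique)
qed

lemma chain_sum_component:
  assumes "inj_on p {..t}" "i \<le> t"
  shows "chain_sum p t $ p i = 1"
proof -
  have "chain_sum p t $ p i = (\<Sum>j\<le>t. if j = i then 1 else 0)"
    unfolding chain_sum_def sum_component
    using assms by (intro sum.cong) (auto simp: axis_def inj_on_def)
  then show ?thesis
    using assms by simp
qed

text \<open>The case split encodes the zero boundary value: at \<open>i = 0\<close> truncated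
  subtraction would read \<open>x $ p 0\<close>.\<close>

lemma chain_diff_component:
  assumes "inj_on q {..t}" "i \<le> t"
  shows "chain_diff p q t x $ q i = x $ p i - (if i = 0 then 0 else x $ p (i - 1))"
proof -
  have "chain_diff p q t x $ q i = axis (q i) 1 \<bullet> chain_diff p q t x"
    by (simp add: inner_axis')
  also have "\<dots> = (\<Sum>j\<le>t. if j = i then x $ p j else 0)
      - (\<Sum>j<t. if Suc j = i then x $ p j else 0)"
    unfolding inner_chain_diff using assms
    by (intro arg_cong2[where f="(-)"] sum.cong) (auto simp: axis_def inj_on_def)
  also have "(\<Sum>j<t. if Suc j = i then x $ p j else 0) = (if i = 0 then 0 else x $ p (i - 1))"
    using assms by (cases i) (simp_all)
  finally show ?thesis
    using assms by simp
qed

text \<open>Adding up all differences telescopes to the last coordinate; this is \<open>B\<close>'s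
  transpose acting on the all-ones vector, in tested form.\<close>

lemma chain_sum_inner_chain_diff:
  assumes "inj_on q {..t}"
  shows "chain_sum q t \<bullet> chain_diff p q t x = x $ p t"
proof -
  have "chain_sum q t \<bullet> chain_diff p q t x = (\<Sum>i\<le>t. x $ p i) - (\<Sum>i<t. x $ p i)"
    unfolding inner_chain_diff
    by (intro arg_cong2[where f="(-)"] sum.cong) (auto simp: chain_sum_component assms)
  then show ?thesis
    by (simp add: lessThan_Suc_atMost[symmetric])
qed

lemma chain_diff_chain_sum:
  assumes "inj_on p {..t}"
  shows "chain_diff p q t (chain_sum p t) = axis (q 0) 1"
proof -
  have "chain_diff p q t (chain_sum p t) = (\<Sum>i\<le>t. axis (q i) 1) - (\<Sum>i<t. axis (q (Suc i)) 1)"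
    unfolding chain_diff_def relabel_def using assms
    by (intro arg_cong2[where f="(-)"] sum.cong) (auto simp: chain_sum_component)
  then show ?thesis
    by (simp add: sum.atMost_shift)
qed

text \<open>Identity part and shift part are both nonexpansive, so the triangle inequality gives the
  factor 2.\<close>

lemma norm_chain_diff_le:
  assumes "inj_on p {..t}" "inj_on q {..t}"
  shows "norm (chain_diff p q t x) \<le> 2 * norm x"
proof -
  have "inj_on p {..<t}"
    using assms(1) by (rule inj_on_subset) auto
  moreover have "inj_on (q \<circ> Suc) {..<t}"
    by (intro comp_inj_on inj_on_subset[OF assms(2)]) auto
  ultimately have "norm (relabel p (q \<circ> Suc) {..<t} x) \<le> norm x"
    by (intro norm_relabel_le) auto
  moreover have "norm (relabel p q {..t} x) \<le> norm x"
    using assms by (intro norm_relabel_le) auto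
  ultimately show ?thesis
    unfolding chain_diff_def
    using norm_triangle_ineq4[of "relabel p q {..t} x" "relabel p (q \<circ> Suc) {..<t} x"] by linarith
qed

text \<open>Positivity allows rescaling to spectral norm exactly \<open>L_A\<close>; the bound 2
  keeps the scaling factor at least \<open>L_A / 2\<close>.\<close>

lemma onorm_chain_diff:
  assumes "inj_on p {..t}" "inj_on q {..t}"
  shows "0 < onorm (chain_diff p q t)" "onorm (chain_diff p q t) \<le> 2"
proof -
  have bl: "bounded_linear (chain_diff p q t)"
    by (rule linear_conv_bounded_linear[THEN iffD1, OF linear_chain_diff])
  have "chain_diff p q t (chain_sum p t) \<noteq> 0"
    by (simp add: chain_diff_chain_sum[OF assms(1)])
  then show "0 < onorm (chain_diff p q t)"
    using onorm_pos_lt[OF bl] by auto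
  show "onorm (chain_diff p q t) \<le> 2"
    by (rule onorm_bound) (use norm_chain_diff_le[OF assms] in auto)
qed

text \<open>The starting direction \<open>A\<^sup>T b\<close> lives at the end \<open>p 0\<close> of the chain and \<open>A\<^sup>T A\<close> is
  tridiagonal along it, while the gradient is blind to everything but the other end \<open>p t\<close>.\<close>

lemma linear_span_chain_support:
  fixes A :: "real ^ 'n::finite ^ 'm::finite"
  assumes inj: "inj_on p {..t}" "inj_on q {..t}"
    and A: "\<And>x. A *v x = s *\<^sub>R chain_diff p q t x"
    and grad: "\<And>x. gradient f x = (c * x $ p t) *\<^sub>R axis (p t) 1"
    and x: "linear_span_assumption f A (s *\<^sub>R axis (q 0) 1) x"
    and "k \<le> t" "k \<le> i" "i \<le> t"
  shows "x k $ p i = 0"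
  using assms(6-)
proof (induction k arbitrary: i rule: less_induct)
  case (less k)
  show ?case
  proof (cases "k = 0")
    case True
    then show ?thesis
      using x by (simp add: linear_span_assumption_def)
  next
    case False
    define b where "b = s *\<^sub>R axis (q 0) (1 :: real)"
    define S where "S = {v :: real ^ 'n. v $ p i = 0}"
    have "subspace S"
      by (simp add: S_def subspace_def)
    moreover have "gradient f (x j) \<in> S \<and> transpose A *v (A *v x j - b) \<in> S" if "j < k" for j
    proof
      \<comment> \<open>In particular \<open>x j $ p t = 0\<close> because \<open>j < t\<close>, so
        the gradient at \<open>x j\<close> is zero.\<close>
      have zero: "x j $ p i' = 0" if "j \<le> i'" "i' \<le> t" for i'
        using less.IH[of j i'] that \<open>j < k\<close> less.prems by simp
      then show "gradient f (x j) \<in> S"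
        using \<open>j < k\<close> less.prems by (simp add: grad S_def)
      define r where "r = A *v x j - b"
      \<comment> \<open>Row \<open>q i'\<close> reads coordinates \<open>i'\<close> and
        \<open>i' - 1\<close>, both at least \<open>j\<close>, and \<open>b\<close> lives at
        \<open>q 0\<close> only.\<close>
      have r: "r $ q i' = 0" if "j < i'" "i' \<le> t" for i'
      proof -
        have "q i' \<noteq> q 0"
          using inj(2) that by (auto simp: inj_on_def)
        then show ?thesis
          using that zero[of i'] zero[of "i' - 1"] inj(2)
          by (simp add: r_def A b_def chain_diff_component axis_def)
      qed
      \<comment> \<open>Column \<open>p i\<close> meets only the rows \<open>q i\<close> and, if
        \<open>i < t\<close>, \<open>q (Suc i)\<close>; both lie beyond \<open>j\<close>, since
        \<open>j < k \<le> i\<close>.\<close>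
      have "(transpose A *v r) $ p i = (transpose A *v r) \<bullet> axis (p i) 1"
        by (simp add: inner_axis)
      also have "\<dots> = r \<bullet> (A *v axis (p i) 1)"
        by (simp add: dot_lmul_matrix transpose_matrix_vector)
      also have "\<dots> = s * ((\<Sum>l\<le>t. axis (p i) 1 $ p l * r $ q l)
          - (\<Sum>l<t. axis (p i) 1 $ p l * r $ q (Suc l)))"
        by (simp add: A inner_chain_diff)
      also have "(\<Sum>l\<le>t. axis (p i) 1 $ p l * r $ q l) = 0"
        using r less.prems \<open>j < k\<close> inj_onD[OF inj(1)]
        by (intro sum.neutral) (force simp: axis_def)
      also have "(\<Sum>l<t. axis (p i) 1 $ p l * r $ q (Suc l)) = 0"
        using r less.prems \<open>j < k\<close> inj_onD[OF inj(1)]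
        by (intro sum.neutral) (force simp: axis_def)
      finally show "transpose A *v (A *v x j - b) \<in> S"
        by (simp add: S_def r_def)
    qed
    ultimately have "span (\<Union>j<k. {gradient f (x j), transpose A *v (A *v x j - b)}) \<subseteq> S"
      by (intro span_minimal) auto
    moreover have "x k \<in> span (\<Union>j<k. {gradient f (x j), transpose A *v (A *v x j - b)})"
      using x False unfolding linear_span_assumption_def b_def by simp
    ultimately show ?thesis
      by (auto simp: S_def)
  qed
qed

section \<open>The hard instance and its two lower bounds\<close>

(* The condition xs \<noteq> 0 excludes the degenerate instances with solution 0,
   for which both lower bounds are 0 and say nothing. *)
theorem theorem3:
  fixes L_f L_A :: real and t :: nat
  assumes "CARD('m::finite) \<le> CARD('n::finite)"
    and "L_f > 0" and "L_A > 0"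
    and "t > 0" and "real t < real CARD('m) / 2"
  shows "\<exists>(X :: (real ^ 'n) set) (f :: real ^ 'n \<Rightarrow> real) (A :: real ^ 'n ^ 'm) (b :: real ^ 'm)
            (xs :: real ^ 'n) (ys :: real ^ 'm).
           admissible_data X f \<and>
           L_f-lipschitz_on UNIV (gradient f) \<and>
           spectral_norm A = L_A \<and>
           primal_dual_solution X f A b xs ys \<and> xs \<noteq> 0 \<and>
           (\<forall>x :: nat \<Rightarrow> real ^ 'n. linear_span_assumption f A b x \<longrightarrow>
              \<bar>f (x t) - f xs\<bar> \<ge>
                3 * L_f * (norm xs)\<^sup>2 / (32 * (real t + 1)) +
                sqrt 6 / (32 * (real t + 1)) * L_A * norm xs * norm ys \<and>
              norm (A *v x t - b) \<ge>
                sqrt 3 * L_A * norm xs / (4 * sqrt 2 * (real t + 1)))"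
proof -
  \<comment> \<open>The chain has \<open>t + 1\<close> indices, and \<open>t < m / 2\<close> leaves
    room for them in both index types.\<close>
  have "card {..t} \<le> CARD('n)" "card {..t} \<le> CARD('m)"
    using assms by auto
  then obtain p :: "nat \<Rightarrow> 'n" and q :: "nat \<Rightarrow> 'm"
    where p: "inj_on p {..t}" and q: "inj_on q {..t}"
    using card_le_inj[of "{..t}" "UNIV :: 'n set"] card_le_inj[of "{..t}" "UNIV :: 'm set"] by auto
  define \<beta> where "\<beta> = onorm (chain_diff p q t)"
  have \<beta>: "0 < \<beta>" "\<beta> \<le> 2"
    unfolding \<beta>_def by (rule onorm_chain_diff[OF p q])+
  define s where "s = L_A / \<beta>"
  have s: "s > 0" "L_A / 2 \<le> s" "L_A = s * \<beta>"
    using assms(3) \<beta> by (simp_all add: s_def field_simps)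
  define f where "f = (\<lambda>x :: real ^ 'n. L_f / 2 * (x $ p t)\<^sup>2)"
  define A where "A = matrix (\<lambda>x. s *\<^sub>R chain_diff p q t x)"
  define b where "b = s *\<^sub>R axis (q 0) (1 :: real)"
  define xs where "xs = chain_sum p t"
  define ys where "ys = (L_f / s) *\<^sub>R chain_sum q t"
  have A: "A *v x = s *\<^sub>R chain_diff p q t x" for x
    unfolding A_def
    using matrix_vector_mul(2)[OF linear_compose_scale_right[OF linear_chain_diff]] by (rule fun_cong)
  have gderiv: "GDERIV f x :> (L_f * x $ p t) *\<^sub>R axis (p t) 1" for x
    unfolding f_def by (rule GDERIV_square_component)
  have grad: "gradient f x = (L_f * x $ p t) *\<^sub>R axis (p t) 1" for x
    by (rule gradient_eqI[OF gderiv])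
  have lipschitz: "L_f-lipschitz_on UNIV (gradient f)"
  proof (rule lipschitz_onI)
    fix x y :: "real ^ 'n"
    have "dist (gradient f x) (gradient f y) = L_f * \<bar>(x - y) $ p t\<bar>"
      using assms(2)
      by (simp add: grad dist_norm abs_mult flip: scaleR_diff_left right_diff_distrib)
    also have "\<dots> \<le> L_f * dist x y"
      using assms(2) component_le_norm_cart[of "x - y" "p t"]
      by (intro mult_left_mono) (simp_all add: dist_norm)
    finally show "dist (gradient f x) (gradient f y) \<le> L_f * dist x y" .
  qed (use assms in simp)
  have "f differentiable at x" for x
    using gderiv[of x] unfolding gderiv_def differentiable_def by blast
  moreover have "convex_on UNIV f"
    unfolding f_def using assms(2) by (intro convex_on_square_component) simp
  ultimately have admissible: "admissible_data UNIV f"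
    using lipschitz by (auto simp: admissible_data_def)
  have norm_A: "spectral_norm A = L_A"
  proof -
    have "bounded_linear (chain_diff p q t)"
      using linear_chain_diff linear_conv_bounded_linear by blast
    moreover have "(*v) A = (\<lambda>x. s *\<^sub>R chain_diff p q t x)"
      by (simp add: fun_eq_iff A)
    ultimately show ?thesis
      using s by (simp add: spectral_norm_def onorm_scaleR \<beta>_def)
  qed
  have xs_p: "xs $ p t = 1"
    by (simp add: xs_def chain_sum_component p)
  have A_xs: "A *v xs = b"
    by (simp add: A xs_def b_def chain_diff_chain_sum p)
  have inner_residual: "chain_sum q t \<bullet> (A *v z - b) = s * (z $ p t - 1)" for z
  proof -
    have "chain_sum q t \<bullet> (A *v z - b) = chain_sum q t \<bullet> (A *v z) - chain_sum q t \<bullet> (A *v xs)"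
      by (simp add: inner_diff_right A_xs)
    then show ?thesis
      by (simp add: A chain_sum_inner_chain_diff q xs_p right_diff_distrib)
  qed
  have "optimal_solution UNIV f A b xs"
  proof -
    \<comment> \<open>The constraint fixes the only coordinate that \<open>f\<close> sees, so
      \<open>f\<close> is constant on the feasible set.\<close>
    have "z $ p t = 1" if "A *v z = b" for z
      using inner_residual[of z] that s by simp
    then show ?thesis
      by (simp add: optimal_solution_def feasible_set_def A_xs f_def xs_p)
  qed
  moreover have "gradient f xs - transpose A *v ys = 0"
  proof -
    have "(transpose A *v ys) \<bullet> z = gradient f xs \<bullet> z" for z
    proof -
      have "(transpose A *v ys) \<bullet> z = ys \<bullet> (A *v z)"
        by (simp add: dot_lmul_matrix transpose_matrix_vector)
      also have "\<dots> = L_f * z $ p t"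
        using s by (simp add: ys_def A chain_sum_inner_chain_diff q)
      finally show ?thesis
        by (simp add: grad xs_p inner_axis')
    qed
    then have "transpose A *v ys = gradient f xs"
      using vector_eq_rdot by blast
    then show ?thesis
      by simp
  qed
  ultimately have primal_dual: "primal_dual_solution UNIV f A b xs ys"
    by (simp add: primal_dual_solution_def)
  have norm_xs: "norm xs = sqrt (real t + 1)"
    by (simp add: xs_def norm_chain_sum p)
  have norm_ys: "norm ys = L_f / s * sqrt (real t + 1)"
    using s assms(2) by (simp add: ys_def norm_chain_sum q)
  have "3 * L_f * (norm xs)\<^sup>2 / (32 * (real t + 1)) +
        sqrt 6 / (32 * (real t + 1)) * L_A * norm xs * norm ys \<le> \<bar>f (x t) - f xs\<bar> \<and>
      sqrt 3 * L_A * norm xs / (4 * sqrt 2 * (real t + 1)) \<le> norm (A *v x t - b)"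
    if x: "linear_span_assumption f A b x" for x
  proof
    have x_t: "x t $ p t = 0"
      using linear_span_chain_support[OF p q A grad x[unfolded b_def]] by simp
    \<comment> \<open>The gap is \<open>16 / 32 * L_f\<close>; the two terms of the bound take at
      most 3/32 and 5/32 of \<open>L_f\<close>.\<close>
    have "3 * L_f * (norm xs)\<^sup>2 / (32 * (real t + 1)) = 3 / 32 * L_f"
      by (simp add: norm_xs field_simps)
    moreover have "sqrt 6 / (32 * (real t + 1)) * L_A * norm xs * norm ys \<le> 5 / 32 * L_f"
    proof -
      have "sqrt 6 / (32 * (real t + 1)) * L_A * norm xs * norm ys
          = sqrt 6 / (32 * (real t + 1)) * L_A * (L_f / s) * (sqrt (real t + 1))\<^sup>2"
        by (simp add: norm_xs norm_ys power2_eq_square)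
      \<comment> \<open>The scale cancels through \<open>L_A / s = \<beta>\<close>.\<close>
      also have "\<dots> = sqrt 6 * \<beta> / 32 * L_f"
        using s by (simp add: field_simps)
      also have "\<dots> \<le> 5 / 32 * L_f"
      proof -
        have "sqrt 6 \<le> 5 / 2"
          by (rule real_le_lsqrt) (simp_all add: power2_eq_square)
        then have "sqrt 6 * \<beta> \<le> 5 / 2 * 2"
          using \<beta> by (intro mult_mono) auto
        then show ?thesis
          using assms(2) by (intro mult_right_mono) auto
      qed
      finally show ?thesis .
    qed
    moreover have "\<bar>f (x t) - f xs\<bar> = L_f / 2"
      using assms(2) by (simp add: f_def x_t xs_p)
    ultimately show "3 * L_f * (norm xs)\<^sup>2 / (32 * (real t + 1)) +
        sqrt 6 / (32 * (real t + 1)) * L_A * norm xs * norm ys \<le> \<bar>f (x t) - f xs\<bar>"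
      using assms(2) by linarith
    \<comment> \<open>As \<open>x t $ p t = 0\<close>, the residual pairs with the all-ones vector
      to \<open>- s\<close>.\<close>
    have "s \<le> sqrt (real t + 1) * norm (A *v x t - b)"
      using Cauchy_Schwarz_ineq2[of "chain_sum q t" "A *v x t - b"] s(1)
      by (simp add: inner_residual x_t norm_chain_sum q)
    then have residual: "L_A / 2 / sqrt (real t + 1) \<le> norm (A *v x t - b)"
      using s(2) by (simp add: field_simps)
    have "sqrt 3 \<le> 2 * sqrt 2"
      by (rule real_le_lsqrt) (simp_all add: power_mult_distrib)
    then have "sqrt 3 / (4 * sqrt 2) \<le> 1 / 2"
      by (simp add: field_simps)
    then have "sqrt 3 / (4 * sqrt 2) * (L_A / sqrt (real t + 1)) \<le> 1 / 2 * (L_A / sqrt (real t + 1))"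
      using assms(3) by (intro mult_right_mono) auto
    moreover have "norm xs / (real t + 1) = 1 / sqrt (real t + 1)"
      by (simp add: norm_xs field_simps)
    then have "sqrt 3 * L_A * norm xs / (4 * sqrt 2 * (real t + 1))
        = sqrt 3 / (4 * sqrt 2) * (L_A / sqrt (real t + 1))"
      by (metis divide_divide_eq_left mult.assoc mult.commute mult.right_neutral
          times_divide_eq_left times_divide_eq_right)
    ultimately show "sqrt 3 * L_A * norm xs / (4 * sqrt 2 * (real t + 1)) \<le> norm (A *v x t - b)"
      using residual by simp
  qed
  moreover have "xs \<noteq> 0"
    using xs_p by auto
  ultimately show ?thesis
    using admissible lipschitz norm_A primal_dual by blast
qed

end
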